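(* Let $G$ be a finitely generated group, and let $\pi$ and $\pi'$ be orthogonal representations of $G$ on separable real Hilbert spaces $\mathcal{H}$ and $\mathcal{H}'$, respectively. Then $\pi$ and $\pi'$ are additive conjugates if and only if $G \curvearrowright b\mathcal{H}$ and $G \curvearrowright b\mathcal{H}'$ are conjugate algebraic actions.
   Context: Two representations $\pi$ on $\mathcal{H}$ and $\pi'$ on $\mathcal{H}'$ of $G$ are additive conjugates if there exists a bijection $\xi \colon \mathcal{H} \to \mathcal{H}'$, not necessarily continuous, such that $\xi(v+w) = \xi(v)+\xi(w)$ and $\xi(\pi_g v) = \pi'_g \xi(v)$ for all $v,w \in \mathcal{H}$ and $g \in G$. With $\mathbb{T} = \mathbb{R}/\mathbb{Z}$, $b\mathcal{H}$ is the group of all (not necessarily continuous) additive maps $\varphi \colon \mathcal{H} \to \mathbb{T}$, with pointwise addition and the subspace topology induced from the product space $\mathbb{T}^{\mathcal{H}}$; it is a compact abelian group. $G$ acts on $b\mathcal{H}$ by $[g\varphi](v) = \varphi(\pi_g^{-1}v)$, and similarly on $b\mathcal{H}'$ via $\pi'$. An algebraic action $G \curvearrowright A$ on a compact group $A$ is a homomorphism from $G$ into the group of continuous group automorphisms of $A$; two algebraic actions $G \curvearrowright A$ and $G \curvearrowright A'$ are conjugate if there is an isomorphism of topological groups $A \to A'$ that intertwines the two actions. *)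

theory Defs
  imports "HOL-Analysis.Analysis" "HOL-Algebra.Bij" "HOL-Algebra.Generated_Groups"
begin

subsection \<open>The circle group\<close>

quotient_type circle = real / "\<lambda>x y :: real. x - y \<in> \<int>"
proof (rule equivpI)
  show "reflp (\<lambda>x y :: real. x - y \<in> \<int>)"
    by (simp add: reflp_def)
  show "symp (\<lambda>x y :: real. x - y \<in> \<int>)"
  proof (rule sympI)
    fix x y :: real
    assume "x - y \<in> \<int>"
    then have "- (x - y) \<in> \<int>"
      by (rule Ints_minus)
    then show "y - x \<in> \<int>"
      by simp
  qed
  show "transp (\<lambda>x y :: real. x - y \<in> \<int>)"
  proof (rule transpI)
    fix x y z :: real
    assume "x - y \<in> \<int>" "y - z \<in> \<int>"
    then have "(x - y) + (y - z) \<in> \<int>"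
      by (rule Ints_add)
    then show "x - z \<in> \<int>"
      by simp
  qed
qed

instantiation circle :: ab_group_add
begin

lift_definition zero_circle :: circle is 0 .

lift_definition plus_circle :: "circle \<Rightarrow> circle \<Rightarrow> circle" is "(+)"
proof -
  fix a b c d :: real
  assume "a - b \<in> \<int>" "c - d \<in> \<int>"
  then have "(a - b) + (c - d) \<in> \<int>"
    by (rule Ints_add)
  then show "(a + c) - (b + d) \<in> \<int>"
    by (simp add: algebra_simps)
qed

lift_definition uminus_circle :: "circle \<Rightarrow> circle" is uminus
proof -
  fix a b :: real
  assume "a - b \<in> \<int>"
  then have "- (a - b) \<in> \<int>"
    by (rule Ints_minus)
  then show "- a - - b \<in> \<int>"
    by simp
qed

lift_definition minus_circle :: "circle \<Rightarrow> circle \<Rightarrow> circle" is "(-)"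
proof -
  fix a b c d :: real
  assume "a - b \<in> \<int>" "c - d \<in> \<int>"
  then have "(a - b) - (c - d) \<in> \<int>"
    by (rule Ints_diff)
  then show "(a - c) - (b - d) \<in> \<int>"
    by (simp add: algebra_simps)
qed

instance
  by standard (transfer, simp add: algebra_simps)+

end

(* The quotient topology of the projection from the real line. *)
instantiation circle :: topological_space
begin

definition open_circle :: "circle set \<Rightarrow> bool"
  where "open_circle U \<longleftrightarrow> open (abs_circle -` U)"

instance
  by standard (auto simp: open_circle_def vimage_Union)

end

lemma abs_circle_eq_iff: "abs_circle x = abs_circle y \<longleftrightarrow> x - y \<in> \<int>"
  by (rule circle.abs_eq_iff)

lemma surj_abs_circle: "surj abs_circle"
  by (metis Quotient3_circle Quotient3_abs_rep surjI)

lemma continuous_on_abs_circle: "continuous_on A abs_circle"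
  by (rule continuous_on_subset[of UNIV])
    (auto simp: continuous_on_open_vimage open_circle_def)

lemma open_abs_circle_image:
  assumes "open U"
  shows "open (abs_circle ` U)"
proof -
  have "abs_circle -` (abs_circle ` U) = (\<Union>n\<in>\<int>. (+) n ` U)"
  proof (intro Set.set_eqI iffI)
    fix x assume "x \<in> abs_circle -` (abs_circle ` U)"
    then obtain u where "u \<in> U" "x - u \<in> \<int>"
      by (auto simp: abs_circle_eq_iff)
    then show "x \<in> (\<Union>n\<in>\<int>. (+) n ` U)"
      by (intro UN_I[of "x - u"] image_eqI[of _ _ u]) auto
  next
    fix x assume "x \<in> (\<Union>n\<in>\<int>. (+) n ` U)"
    then obtain n u where "n \<in> \<int>" "u \<in> U" "x = n + u"
      by blast
    then have "abs_circle x = abs_circle u"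
      by (simp add: abs_circle_eq_iff)
    with \<open>u \<in> U\<close> show "x \<in> abs_circle -` (abs_circle ` U)"
      by simp
  qed
  then show ?thesis
    using assms by (simp add: open_circle_def open_UN open_translation)
qed

instance circle :: topological_group_add
proof
  fix a b :: circle
  obtain x y where ab: "a = abs_circle x" "b = abs_circle y"
    using surj_abs_circle by (metis surjD)
  show "((\<lambda>p. fst p + snd p) \<longlongrightarrow> a + b) (nhds a \<times>\<^sub>F nhds b)"
  proof (rule topological_tendstoI)
    fix W assume W: "open W" "a + b \<in> W"
    have "((\<lambda>p. fst p + snd p) \<longlongrightarrow> x + y) (nhds x \<times>\<^sub>F nhds y)"
      by (rule tendsto_add_Pair)
    moreover have "open (abs_circle -` W)" "x + y \<in> abs_circle -` W"
      using W by (simp_all add: ab open_circle_def plus_circle.abs_eq)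
    ultimately have "\<forall>\<^sub>F p in nhds x \<times>\<^sub>F nhds y. fst p + snd p \<in> abs_circle -` W"
      by (rule topological_tendstoD)
    then obtain P Q where PQ: "eventually P (nhds x)" "eventually Q (nhds y)"
      "\<And>u v. P u \<Longrightarrow> Q v \<Longrightarrow> u + v \<in> abs_circle -` W"
      by (auto simp: eventually_prod_filter)
    obtain U where U: "open U" "x \<in> U" "\<forall>u\<in>U. P u"
      using PQ(1) unfolding eventually_nhds by blast
    obtain V where V: "open V" "y \<in> V" "\<forall>v\<in>V. Q v"
      using PQ(2) unfolding eventually_nhds by blast
    have "\<forall>\<^sub>F c in nhds a. c \<in> abs_circle ` U" "\<forall>\<^sub>F c in nhds b. c \<in> abs_circle ` V"
      using U V by (simp_all add: ab eventually_nhds_in_open open_abs_circle_image)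
    moreover have "c + d \<in> W" if "c \<in> abs_circle ` U" "d \<in> abs_circle ` V" for c d
    proof -
      obtain u v where "u \<in> U" "v \<in> V" "c = abs_circle u" "d = abs_circle v"
        using \<open>c \<in> abs_circle ` U\<close> \<open>d \<in> abs_circle ` V\<close> by blast
      with PQ(3)[of u v] U V show ?thesis
        by (simp add: plus_circle.abs_eq)
    qed
    ultimately show "\<forall>\<^sub>F p in nhds a \<times>\<^sub>F nhds b. fst p + snd p \<in> W"
      unfolding eventually_prod_filter
      by (intro exI[of _ "\<lambda>c. c \<in> abs_circle ` U"] exI[of _ "\<lambda>c. c \<in> abs_circle ` V"]) simp
  qed
  show "(uminus \<longlongrightarrow> - a) (nhds a)"
  proof (rule topological_tendstoI)
    fix W assume W: "open W" "- a \<in> W"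
    have "abs_circle -` (uminus -` W) = uminus -` (abs_circle -` W)"
      by (simp add: vimage_def uminus_circle.abs_eq)
    moreover have "open (uminus -` (abs_circle -` W))"
      using W by (intro open_vimage[OF _ continuous_on_minus[OF continuous_on_id]]) (simp add: open_circle_def)
    ultimately have "open (uminus -` W)"
      by (simp add: open_circle_def)
    with W show "\<forall>\<^sub>F c in nhds a. - c \<in> W"
      using eventually_nhds_in_open[of "uminus -` W" a] by simp
  qed
qed

instance circle :: t2_space
proof
  fix a b :: circle
  assume "a \<noteq> b"
  obtain x y where ab: "a = abs_circle x" "b = abs_circle y"
    using surj_abs_circle by (metis surjD)
  define e where "e = (\<lambda>c. cis (2 * pi * rep_circle c))"
  have e: "e (abs_circle t) = cis (2 * pi * t)" for t
  proof -
    have "rep_circle (abs_circle t) - t \<in> \<int>"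
      by (metis abs_circle_eq_iff Quotient3_abs_rep Quotient3_circle)
    then obtain n where "rep_circle (abs_circle t) = t + of_int n"
      by (metis Ints_cases add_diff_cancel_left' diff_add_cancel add.commute)
    then show ?thesis
      by (simp add: e_def distrib_left flip: cis_mult)
  qed
  have "e a \<noteq> e b"
  proof
    assume "e a = e b"
    then have "cis (2 * pi * (x - y)) = 1"
      by (simp add: ab e right_diff_distrib flip: cis_divide)
    then have "cos (2 * pi * (x - y)) = 1"
      by (metis cis.simps(1) one_complex.simps(1))
    then obtain n :: int where "2 * pi * (x - y) = of_int n * 2 * pi"
      by (metis cos_one_2pi_int)
    then have "x - y = of_int n"
      by simp
    with \<open>a \<noteq> b\<close> show False
      by (simp add: ab abs_circle_eq_iff)
  qed
  then obtain U V where UV: "open U" "open V" "e a \<in> U" "e b \<in> V" "U \<inter> V = {}"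
    using hausdorff by metis
  have "open (e -` S)" if "open S" for S
  proof -
    have "abs_circle -` (e -` S) = (\<lambda>t. cis (2 * pi * t)) -` S"
      by (auto simp: e)
    also have "open \<dots>"
      by (intro open_vimage that continuous_intros)
    finally show ?thesis
      by (simp add: open_circle_def)
  qed
  with UV show "\<exists>U V. open U \<and> open V \<and> a \<in> U \<and> b \<in> V \<and> U \<inter> V = {}"
    by (intro exI[of _ "e -` U"] exI[of _ "e -` V"]) auto
qed

lemma compact_circle: "compact (UNIV :: circle set)"
proof -
  have "abs_circle ` {0..1} = UNIV"
  proof (intro Set.set_eqI iffI UNIV_I)
    fix c
    obtain x where "c = abs_circle x"
      using surj_abs_circle by (metis surjD)
    then have "c = abs_circle (frac x)"
      by (simp add: abs_circle_eq_iff frac_def)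
    then show "c \<in> abs_circle ` {0..1}"
      by (auto simp: frac_ge_0 frac_lt_1 less_imp_le)
  qed
  then show ?thesis
    by (metis compact_continuous_image continuous_on_abs_circle compact_Icc)
qed


subsection \<open>Representations\<close>

definition finitely_generated :: "('g, 'm) monoid_scheme \<Rightarrow> bool"
  where "finitely_generated G \<longleftrightarrow>
    (\<exists>S. finite S \<and> S \<subseteq> carrier G \<and> generate G S = carrier G)"

(* In infinite dimension orthogonal_transformation does not include surjectivity,
   which comes from Bij. *)
definition orthogonal_group :: "('h::real_inner \<Rightarrow> 'h) monoid"
  where "orthogonal_group =
    (BijGroup UNIV)\<lparr>carrier := {f \<in> Bij UNIV. orthogonal_transformation f}\<rparr>"

definition orthogonal_representation ::
    "('g, 'm) monoid_scheme \<Rightarrow> ('g \<Rightarrow> 'h::real_inner \<Rightarrow> 'h) \<Rightarrow> bool"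
  where "orthogonal_representation G \<pi> \<longleftrightarrow> \<pi> \<in> hom G orthogonal_group"

definition additive_conjugates ::
    "('g, 'm) monoid_scheme \<Rightarrow> ('g \<Rightarrow> 'h::plus \<Rightarrow> 'h) \<Rightarrow> ('g \<Rightarrow> 'k::plus \<Rightarrow> 'k) \<Rightarrow> bool"
  where "additive_conjugates G \<pi> \<pi>' \<longleftrightarrow>
    (\<exists>\<xi>. bij \<xi> \<and> (\<forall>v w. \<xi> (v + w) = \<xi> v + \<xi> w) \<and>
         (\<forall>g\<in>carrier G. \<forall>v. \<xi> (\<pi> g v) = \<pi>' g (\<xi> v)))"


subsection \<open>Algebraic actions\<close>

definition compact_group :: "('a, 'm) monoid_scheme \<Rightarrow> 'a topology \<Rightarrow> bool"
  where "compact_group A X \<longleftrightarrow>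
    group A \<and> topspace X = carrier A \<and>
    continuous_map (prod_topology X X) X (\<lambda>(a, b). a \<otimes>\<^bsub>A\<^esub> b) \<and>
    continuous_map X X (\<lambda>a. inv\<^bsub>A\<^esub> a) \<and>
    compact_space X \<and> Hausdorff_space X"

definition continuous_automorphisms ::
    "('a, 'm) monoid_scheme \<Rightarrow> 'a topology \<Rightarrow> ('a \<Rightarrow> 'a) monoid"
  where "continuous_automorphisms A X =
    (AutoGroup A)\<lparr>carrier := {f \<in> auto A. continuous_map X X f}\<rparr>"

definition algebraic_action ::
    "('g, 'm) monoid_scheme \<Rightarrow> ('a, 'n) monoid_scheme \<Rightarrow> 'a topology \<Rightarrow> ('g \<Rightarrow> 'a \<Rightarrow> 'a) \<Rightarrow> bool"
  where "algebraic_action G A X \<alpha> \<longleftrightarrow>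
    compact_group A X \<and> \<alpha> \<in> hom G (continuous_automorphisms A X)"

definition conjugate_algebraic_actions ::
    "('g, 'm) monoid_scheme \<Rightarrow>
     ('a, 'n) monoid_scheme \<Rightarrow> 'a topology \<Rightarrow> ('g \<Rightarrow> 'a \<Rightarrow> 'a) \<Rightarrow>
     ('b, 'p) monoid_scheme \<Rightarrow> 'b topology \<Rightarrow> ('g \<Rightarrow> 'b \<Rightarrow> 'b) \<Rightarrow> bool"
  where "conjugate_algebraic_actions G A X \<alpha> A' X' \<alpha>' \<longleftrightarrow>
    algebraic_action G A X \<alpha> \<and> algebraic_action G A' X' \<alpha>' \<and>
    (\<exists>\<theta>\<in>iso A A'. homeomorphic_map X X' \<theta> \<and>
       (\<forall>g\<in>carrier G. \<forall>a\<in>carrier A. \<theta> (\<alpha> g a) = \<alpha>' g (\<theta> a)))"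


subsection \<open>The group of additive maps to the circle\<close>

definition b_group :: "('h::ab_group_add \<Rightarrow> circle) monoid"
  where "b_group =
    \<lparr>carrier = {\<phi>. \<forall>v w. \<phi> (v + w) = \<phi> v + \<phi> w},
     mult = (\<lambda>\<phi> \<psi> v. \<phi> v + \<psi> v),
     one = (\<lambda>_. 0)\<rparr>"

definition b_topology :: "('h::ab_group_add \<Rightarrow> circle) topology"
  where "b_topology = subtopology (product_topology (\<lambda>_. euclidean) UNIV) (carrier b_group)"

(* Automorphisms in AutoGroup are extensional, hence the restriction to the carrier. *)
definition b_action ::
    "('g \<Rightarrow> 'h \<Rightarrow> 'h) \<Rightarrow> 'g \<Rightarrow> ('h::ab_group_add \<Rightarrow> circle) \<Rightarrow> ('h \<Rightarrow> circle)"
  where "b_action \<pi> g = (\<lambda>\<phi>\<in>carrier b_group. \<lambda>v. \<phi> (inv_into UNIV (\<pi> g) v))"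

lemma group_b_group: "group (b_group :: ('h::ab_group_add \<Rightarrow> circle) monoid)"
proof (rule groupI)
  fix \<phi> :: "'h \<Rightarrow> circle"
  assume "\<phi> \<in> carrier b_group"
  then show "\<exists>\<psi>\<in>carrier b_group. \<psi> \<otimes>\<^bsub>b_group\<^esub> \<phi> = \<one>\<^bsub>b_group\<^esub>"
    by (intro bexI[of _ "\<lambda>v. - \<phi> v"]) (auto simp: b_group_def)
qed (auto simp: b_group_def algebra_simps fun_eq_iff)

lemma inv_b_group: "inv\<^bsub>b_group\<^esub> \<phi> = (\<lambda>v. - \<phi> v)" if "\<phi> \<in> carrier b_group"
  by (rule group.inv_equality[OF group_b_group]) (use that in \<open>auto simp: b_group_def\<close>)

lemma topspace_b_topology: "topspace b_topology = carrier b_group"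
  by (simp add: b_topology_def)

lemma continuous_map_b_eval: "continuous_map b_topology euclidean (\<lambda>\<phi>. \<phi> v)"
  unfolding b_topology_def
  by (intro continuous_map_from_subtopology continuous_map_product_projection) simp

lemma continuous_map_into_b:
  assumes "\<And>v. continuous_map X euclidean (\<lambda>x. f x v)" "f \<in> topspace X \<rightarrow> carrier b_group"
  shows "continuous_map X b_topology f"
  unfolding b_topology_def continuous_map_in_subtopology continuous_map_componentwise_UNIV
  using assms by auto

lemma compact_group_b: "compact_group (b_group :: ('h::ab_group_add \<Rightarrow> circle) monoid) b_topology"
  unfolding compact_group_def
proof (intro conjI group_b_group topspace_b_topology)
  let ?B = "b_group :: ('h \<Rightarrow> circle) monoid"
  have fst: "continuous_map (prod_topology b_topology b_topology) euclidean (\<lambda>p. fst p v)"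
    and snd: "continuous_map (prod_topology b_topology b_topology) euclidean (\<lambda>p. snd p v)"
    for v :: 'h
    using continuous_map_compose[OF continuous_map_fst continuous_map_b_eval]
      continuous_map_compose[OF continuous_map_snd continuous_map_b_eval]
    by (auto simp: o_def)
  show "continuous_map (prod_topology b_topology b_topology) b_topology (\<lambda>(a, b). a \<otimes>\<^bsub>?B\<^esub> b)"
  proof (rule continuous_map_into_b)
    fix v :: 'h
    show "continuous_map (prod_topology b_topology b_topology) euclidean
        (\<lambda>p. (case p of (a, b) \<Rightarrow> a \<otimes>\<^bsub>?B\<^esub> b) v)"
      using fst[of v] snd[of v]
      by (auto simp: continuous_map_atin b_group_def case_prod_unfold intro!: tendsto_add)
  qed (auto simp: topspace_b_topology b_group_def algebra_simps)
  have "continuous_map b_topology euclidean (\<lambda>a. - a v)" for v :: 'h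
    using continuous_map_b_eval[of v] by (simp add: continuous_map_atin tendsto_minus)
  then have "continuous_map b_topology b_topology (\<lambda>a (v :: 'h). - a v)"
    by (intro continuous_map_into_b) (auto simp: topspace_b_topology b_group_def)
  then show "continuous_map b_topology b_topology (\<lambda>a. inv\<^bsub>?B\<^esub> a)"
    by (rule continuous_map_eq) (simp add: topspace_b_topology inv_b_group)
  have "closed (carrier ?B)"
    unfolding b_group_def
    by (auto intro!: closed_Collect_all closed_Collect_eq continuous_intros continuous_on_product_coordinates)
  moreover have "compact_space (product_topology (\<lambda>_. euclidean) UNIV :: ('h \<Rightarrow> circle) topology)"
    unfolding compact_space_product_topology
    using compact_circle by (simp add: compact_space_def)
  ultimately show "compact_space (b_topology :: ('h \<Rightarrow> circle) topology)"
    unfolding b_topology_def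
    by (intro compact_space_subtopology closedin_compact_space)
      (auto simp: euclidean_product_topology)
  have "Hausdorff_space (euclidean :: circle topology)"
    unfolding Hausdorff_space_def disjnt_def by (metis hausdorff open_openin)
  then show "Hausdorff_space (b_topology :: ('h \<Rightarrow> circle) topology)"
    unfolding b_topology_def
    by (simp add: Hausdorff_space_subtopology Hausdorff_space_product_topology)
qed

lemma algebraic_action_b:
  fixes \<pi> :: "'g \<Rightarrow> 'h::real_inner \<Rightarrow> 'h"
  assumes "group G" and "orthogonal_representation G \<pi>"
  shows "algebraic_action G b_group b_topology (b_action \<pi>)"
proof -
  let ?B = "b_group :: ('h \<Rightarrow> circle) monoid"
  let ?\<rho> = "\<lambda>g. inv_into UNIV (\<pi> g)"
  have bij: "bij (\<pi> g)" and lin: "linear (\<pi> g)" if "g \<in> carrier G" for g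
    using assms(2) that
    by (auto simp: orthogonal_representation_def orthogonal_group_def hom_def Bij_def
        orthogonal_transformation_def)
  have mult: "\<pi> (g \<otimes>\<^bsub>G\<^esub> h) = \<pi> g \<circ> \<pi> h" if "g \<in> carrier G" "h \<in> carrier G" for g h
    using assms(2) that
    by (auto simp: orthogonal_representation_def orthogonal_group_def hom_def BijGroup_def
        compose_def fun_eq_iff Pi_iff)
  have add: "?\<rho> g (v + w) = ?\<rho> g v + ?\<rho> g w" if "g \<in> carrier G" for g v w
  proof (rule inv_f_eq[OF bij_is_inj[OF bij[OF that]]])
    show "\<pi> g (?\<rho> g v + ?\<rho> g w) = v + w"
      using bij[OF that] by (simp add: linear_add[OF lin[OF that]] bij_is_surj surj_f_inv_f)
  qed
  have carr: "(\<lambda>v. \<phi> (?\<rho> g v)) \<in> carrier ?B" if "g \<in> carrier G" "\<phi> \<in> carrier ?B" for g \<phi>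
    using that by (simp add: b_group_def add)
  have bijB: "b_action \<pi> g \<in> Bij (carrier ?B)" if g: "g \<in> carrier G" for g
  proof -
    have "bij_betw (b_action \<pi> g) (carrier ?B) (carrier ?B)"
    proof (rule bij_betw_byWitness[where f' = "\<lambda>\<phi> v. \<phi> (\<pi> g v)"])
      show "\<forall>\<phi>\<in>carrier ?B. (\<lambda>v. b_action \<pi> g \<phi> (\<pi> g v)) = \<phi>"
        using bij[OF g] by (simp add: b_action_def bij_is_inj)
      have comp: "(\<lambda>v. \<phi> (\<pi> g v)) \<in> carrier ?B" if "\<phi> \<in> carrier ?B" for \<phi>
        using that by (simp add: b_group_def linear_add[OF lin[OF g]])
      then show "(\<lambda>\<phi> v. \<phi> (\<pi> g v)) ` carrier ?B \<subseteq> carrier ?B"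
        by blast
      show "\<forall>\<phi>\<in>carrier ?B. b_action \<pi> g (\<lambda>v. \<phi> (\<pi> g v)) = \<phi>"
        using bij[OF g] comp by (simp add: b_action_def bij_is_surj surj_f_inv_f)
      show "b_action \<pi> g ` carrier ?B \<subseteq> carrier ?B"
        using carr[OF g] by (auto simp: b_action_def)
    qed
    then show ?thesis
      by (simp add: Bij_def b_action_def)
  qed
  have homB: "b_action \<pi> g \<in> hom ?B ?B" if g: "g \<in> carrier G" for g
  proof (rule homI)
    fix \<phi> \<psi> assume "\<phi> \<in> carrier ?B" "\<psi> \<in> carrier ?B"
    moreover from this have "\<phi> \<otimes>\<^bsub>?B\<^esub> \<psi> \<in> carrier ?B"
      by (simp add: group_b_group group.is_monoid monoid.m_closed)
    ultimately show "b_action \<pi> g (\<phi> \<otimes>\<^bsub>?B\<^esub> \<psi>) = b_action \<pi> g \<phi> \<otimes>\<^bsub>?B\<^esub> b_action \<pi> g \<psi>"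
      by (simp add: b_action_def) (simp add: b_group_def)
  qed (simp add: b_action_def carr[OF g])
  have contB: "continuous_map b_topology b_topology (b_action \<pi> g)" if g: "g \<in> carrier G" for g
  proof (rule continuous_map_eq)
    show "continuous_map b_topology b_topology (\<lambda>\<phi> v. \<phi> (?\<rho> g v) :: circle)"
      using carr[OF g]
      by (intro continuous_map_into_b continuous_map_b_eval) (auto simp: topspace_b_topology)
  qed (simp add: topspace_b_topology b_action_def)
  have "b_action \<pi> \<in> hom G (continuous_automorphisms ?B b_topology)"
  proof (rule homI)
    fix g h assume gh: "g \<in> carrier G" "h \<in> carrier G"
    have "b_action \<pi> (g \<otimes>\<^bsub>G\<^esub> h) = compose (carrier ?B) (b_action \<pi> g) (b_action \<pi> h)"
      using carr gh
      by (auto simp: b_action_def compose_def mult o_inv_distrib bij fun_eq_iff)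
    then show "b_action \<pi> (g \<otimes>\<^bsub>G\<^esub> h) =
        b_action \<pi> g \<otimes>\<^bsub>continuous_automorphisms ?B b_topology\<^esub> b_action \<pi> h"
      using bijB gh by (simp add: continuous_automorphisms_def AutoGroup_def BijGroup_def)
  qed (simp add: continuous_automorphisms_def auto_def homB bijB contB)
  then show ?thesis
    by (simp add: algebraic_action_def compact_group_b)
qed

end

theory Submission
  imports Defs
begin

text \<open>An additive bijection acts on characters by precomposition with its inverse. Conversely, by
  Pontryagin duality every continuous character of \<open>bH\<close> is evaluation at a vector of \<open>H\<close>, so an
  isomorphism of the dual groups and its inverse are both dual to additive maps, and these are mutually
  inverse and equivariant because \<open>bH\<close> separates points.

  Duality is elementary here. As the circle has no small subgroups, a continuous character kills the
  annihilator of some finite set \<open>F\<close>. The subgroup generated by \<open>F\<close> is contained in the integral span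
  of a finite rationally independent set \<open>U\<close>, and each coordinate functional on \<open>U\<close> extends to a
  rational linear functional on \<open>H\<close>, whose real multiples form a one-parameter subgroup of \<open>bH\<close>.
  The character is linear along each of these, and with an integral slope since it kills the
  annihilator of \<open>U\<close>; these slopes are the coordinates of the desired vector.\<close>

section \<open>The circle as the group of unit complex numbers\<close>

lemma abs_circle_add: "abs_circle (x + y) = abs_circle x + abs_circle y"
  by (simp add: plus_circle.abs_eq)

lemma abs_circle_eq_0_iff: "abs_circle x = 0 \<longleftrightarrow> x \<in> \<int>"
  by (simp add: zero_circle_def abs_circle_eq_iff)

lemma abs_circle_sum: "abs_circle (sum f A) = (\<Sum>x\<in>A. abs_circle (f x))"
  by (induction A rule: infinite_finite_induct) (auto simp: abs_circle_add abs_circle_eq_0_iff)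

lemma cis_2pi_eq_iff: "cis (2 * pi * x) = cis (2 * pi * y) \<longleftrightarrow> x - y \<in> \<int>"
proof
  assume "cis (2 * pi * x) = cis (2 * pi * y)"
  then have "cis (2 * pi * (x - y)) = 1"
    by (simp add: right_diff_distrib flip: cis_divide)
  then have "cos (2 * pi * (x - y)) = 1"
    by (metis cis.simps(1) one_complex.simps(1))
  then obtain n :: int where "2 * pi * (x - y) = of_int n * 2 * pi"
    by (metis cos_one_2pi_int)
  then show "x - y \<in> \<int>"
    by simp
next
  assume "x - y \<in> \<int>"
  then obtain n where "x = y + of_int n"
    by (metis Ints_cases diff_eq_eq add.commute)
  then show "cis (2 * pi * x) = cis (2 * pi * y)"
    by (simp add: distrib_left flip: cis_mult)
qed

text \<open>The standard embedding of the circle into the complex plane. It makes the complex norm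
  available for measuring distance from the neutral element, and complex logarithms for lifting
  paths.\<close>

lift_definition circle_exp :: "circle \<Rightarrow> complex" is "\<lambda>x. cis (2 * pi * x)"
  by (simp add: cis_2pi_eq_iff)

lemma circle_exp_eq_iff: "circle_exp a = circle_exp b \<longleftrightarrow> a = b"
  by transfer (rule cis_2pi_eq_iff)

lemma circle_exp_0: "circle_exp 0 = 1"
  by transfer simp

lemma circle_exp_add: "circle_exp (a + b) = circle_exp a * circle_exp b"
  by transfer (simp add: cis_mult distrib_left)

lemma norm_circle_exp: "norm (circle_exp a) = 1"
  by transfer simp

lemma continuous_on_circle_exp: "continuous_on A circle_exp"
proof (rule continuous_on_subset[of UNIV])
  have "open (circle_exp -` S)" if "open S" for S
  proof -
    have "abs_circle -` (circle_exp -` S) = (\<lambda>t. cis (2 * pi * t)) -` S"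
      by (auto simp: circle_exp.abs_eq)
    also have "open \<dots>"
      by (intro open_vimage that continuous_intros)
    finally show ?thesis
      by (simp add: open_circle_def)
  qed
  then show "continuous_on UNIV circle_exp"
    by (simp add: continuous_on_open_vimage)
qed simp

text \<open>If \<open>z\<close> is within \<open>1/2\<close> of \<open>1\<close>, then \<open>1 - z\<^sup>2 = (1 - z) (1 + z)\<close> exceeds
  \<open>1 - z\<close> in norm by a factor \<open>3/2\<close>, so repeated doubling leaves the disc.\<close>

lemma no_small_circle_subgroups:
  fixes a :: circle
  assumes "\<And>n. norm (1 - circle_exp (((\<lambda>b. b + b) ^^ n) a)) < 1/2"
  shows "a = 0"
proof (rule ccontr)
  assume "a \<noteq> 0"
  then have pos: "norm (1 - circle_exp a) > 0"
    by (metis circle_exp_0 circle_exp_eq_iff eq_iff_diff_eq_0 zero_less_norm_iff)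
  have growth: "norm (1 - circle_exp (((\<lambda>b. b + b) ^^ n) a)) \<ge> (3/2)^n * norm (1 - circle_exp a)" for n
  proof (induction n)
    case (Suc n)
    let ?z = "circle_exp (((\<lambda>b. b + b) ^^ n) a)"
    have eq: "1 - ?z * ?z = (1 - ?z) * (2 - (1 - ?z))"
      by (simp add: algebra_simps)
    have "norm (1 - ?z * ?z) = norm (1 - ?z) * norm (2 - (1 - ?z))"
      unfolding eq norm_mult ..
    moreover have ge: "3/2 \<le> norm (2 - (1 - ?z))"
      using norm_triangle_ineq2[of 2 "1 - ?z"] assms[of n] by simp
    ultimately have "norm (1 - ?z) * (3/2) \<le> norm (1 - ?z * ?z)"
      using mult_left_mono[OF ge norm_ge_zero[of "1 - ?z"]] by linarith
    with Suc have "3/2 * ((3/2)^n * norm (1 - circle_exp a)) \<le> norm (1 - ?z * ?z)"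
      by linarith
    then show ?case
      by (simp add: circle_exp_add mult.assoc)
  qed simp
  obtain n where "1 / norm (1 - circle_exp a) < (3/2)^n"
    using real_arch_pow[of "3/2"] by auto
  then have "1 < (3/2)^n * norm (1 - circle_exp a)"
    using pos by (simp add: divide_less_eq)
  with growth[of n] assms[of n] show False
    by linarith
qed

section \<open>Continuous homomorphisms from the real line to the circle\<close>

text \<open>The real line is contractible, so the nowhere vanishing map
  \<open>circle_exp (f t)\<close> has a continuous logarithm. Unit modulus makes its real part zero,
  and its imaginary part over \<open>2 * pi\<close> is the lift.\<close>

lemma circle_path_lift:
  fixes f :: "real \<Rightarrow> circle"
  assumes "continuous_on UNIV f"
  obtains h where "continuous_on UNIV h" "\<And>t. f t = abs_circle (h t)"
proof -
  have cont: "continuous_on UNIV (\<lambda>t. circle_exp (f t))"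
    using assms by (rule continuous_on_compose2[OF continuous_on_circle_exp]) auto
  have "circle_exp (f t) \<noteq> 0" for t
    using norm_circle_exp[of "f t"] by auto
  then obtain g where g: "continuous_on UNIV g" "\<And>t. circle_exp (f t) = exp (g t)"
    using continuous_logarithm_on_contractible[OF cont contractible_UNIV] by (metis UNIV_I)
  show thesis
  proof
    show "continuous_on UNIV (\<lambda>t. Im (g t) / (2 * pi))"
      by (intro continuous_intros g(1)) auto
    fix t
    have "exp (Re (g t)) = 1"
      by (metis g(2) norm_circle_exp norm_exp_eq_Re)
    then have "circle_exp (f t) = cis (Im (g t))"
      by (simp add: g(2) exp_eq_polar)
    also have "\<dots> = circle_exp (abs_circle (Im (g t) / (2 * pi)))"
      by (simp add: circle_exp.abs_eq)
    finally show "f t = abs_circle (Im (g t) / (2 * pi))"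
      by (simp add: circle_exp_eq_iff)
  qed
qed

text \<open>Additivity alone settles rational arguments, after clearing denominators; continuity and
  density of the rationals settle the others.\<close>

lemma continuous_additive_real:
  fixes k :: "real \<Rightarrow> real"
  assumes cont: "continuous_on UNIV k" and add: "\<And>s t. k (s + t) = k s + k t"
  shows "k t = t * k 1"
proof -
  interpret k: additive k
    by standard (rule add)
  have nat: "k (of_nat n * x) = of_nat n * k x" for n x
    by (induction n) (simp_all add: k.zero add distrib_right)
  have int: "k (of_int n * x) = of_int n * k x" for n x
    using nat[of _ x] k.minus by (cases n rule: int_cases2) simp_all
  have "k t - t * k 1 = 0" if rat: "t \<in> \<rat>" for t
  proof -
    obtain b a where ab: "b > 0" "coprime a b" "t = of_int a / of_int b"
      using rat by (rule Rats_cases')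
    then have "of_int b * t = of_int a * 1"
      by simp
    then have "of_int b * k t = of_int a * k 1"
      by (metis int)
    then have "k t = of_int a * k 1 / of_int b"
      using ab(1) by (simp add: eq_divide_eq mult.commute)
    then show ?thesis
      by (simp add: ab(3))
  qed
  moreover have "continuous_on (closure \<rat>) (\<lambda>t. k t - t * k 1)"
    by (intro continuous_intros continuous_on_subset[OF cont]) auto
  moreover have "t \<in> closure \<rat>"
    by (simp add: Rats_closure_real)
  ultimately have "k t - t * k 1 = 0"
    using continuous_constant_on_closure[where f = "\<lambda>t. k t - t * k 1" and S = "\<rat>" and a = 0 and x = t]
    by blast
  then show ?thesis
    by simp
qed

text \<open>The line is connected, while distinct integers are at distance at least
  \<open>1\<close>.\<close>

lemma continuous_Ints_constant:
  fixes d :: "real \<Rightarrow> real"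
  assumes "continuous_on UNIV d" "\<And>t. d t \<in> \<int>"
  shows "d s = d t"
proof -
  have "d constant_on UNIV"
  proof (rule continuous_discrete_range_constant)
    fix x
    have "1 \<le> norm (d y - d x)" if "d y \<noteq> d x" for y
      using that Ints_nonzero_abs_ge1[OF Ints_diff[OF assms(2)[of y] assms(2)[of x]]] by simp
    then show "\<exists>e>0. \<forall>y. y \<in> UNIV \<and> d y \<noteq> d x \<longrightarrow> e \<le> norm (d y - d x)"
      by (metis zero_less_one)
  qed (use assms in auto)
  then show ?thesis
    by (metis UNIV_I constant_on_def)
qed

text \<open>A continuous lift \<open>h\<close> of \<open>f\<close> is additive up to an integer
  defect, which is constant by continuity. Normalising \<open>h\<close> to vanish at
  \<open>0\<close> therefore makes it additive, hence linear.\<close>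

lemma continuous_additive_circle:
  fixes f :: "real \<Rightarrow> circle"
  assumes cont: "continuous_on UNIV f" and add: "\<And>s t. f (s + t) = f s + f t"
  obtains c where "\<And>t. f t = abs_circle (t * c)"
proof -
  obtain h where h: "continuous_on UNIV h" "\<And>t. f t = abs_circle (h t)"
    using circle_path_lift[OF cont] by blast
  \<comment> \<open>Comparison with \<open>t = 0\<close> shows that the defect is
    \<open>- h 0\<close>, for every \<open>s\<close>.\<close>
  have "h (s + t) - h s - h t = h (s + 0) - h s - h 0" for s t
  proof (rule continuous_Ints_constant[of "\<lambda>t. h (s + t) - h s - h t"])
    show "continuous_on UNIV (\<lambda>t. h (s + t) - h s - h t)"
      by (intro continuous_intros h(1) continuous_on_compose2[OF h(1)]) auto
    show "h (s + t) - h s - h t \<in> \<int>" for t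
      using add[of s t] by (simp add: h(2) abs_circle_eq_iff diff_diff_eq flip: abs_circle_add)
  qed
  then have add': "h (s + t) - h 0 = (h s - h 0) + (h t - h 0)" for s t
    by (simp add: algebra_simps)
  have lin: "h t - h 0 = t * (h 1 - h 0)" for t
  proof (rule continuous_additive_real)
    show "continuous_on UNIV (\<lambda>t. h t - h 0)"
      by (intro continuous_intros h(1))
  qed (rule add')
  \<comment> \<open>The normalising constant \<open>h 0\<close> is an integer, so subtracting it
    does not change the class in the circle.\<close>
  have "f 0 = 0"
    using add[of 0 0] by simp
  then have "h 0 \<in> \<int>"
    by (simp add: h(2) abs_circle_eq_0_iff)
  then have "f t = abs_circle (t * (h 1 - h 0))" for t
    by (simp add: h(2) abs_circle_eq_iff flip: lin)
  then show thesis
    by (rule that)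
qed

section \<open>Integral coordinates for finitely many vectors\<close>

lemma common_denominator:
  assumes "finite Q"
  obtains N :: int where "N > 0" "\<And>q::rat. q \<in> Q \<Longrightarrow> of_int N * q \<in> \<int>"
proof -
  have "\<exists>N::int. N > 0 \<and> (\<forall>q\<in>Q. of_int N * q \<in> \<int>)"
    using assms
  proof induction
    case empty
    then show ?case
      using zero_less_one by blast
  next
    case (insert q Q)
    then obtain N :: int where N: "N > 0" "\<forall>q\<in>Q. of_int N * q \<in> \<int>"
      by blast
    obtain a b :: int where ab: "b > 0" "q = of_int a / of_int b"
      by (metis Rat_cases Fract_of_int_quotient)
    have "of_int (N * b) * r \<in> \<int>" if "r \<in> insert q Q" for r
    proof (cases "r = q")
      case True
      then have "of_int (N * b) * r = of_int (N * a)"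
        using ab by simp
      then show ?thesis
        by (metis Ints_of_int)
    next
      case False
      then have "of_int (N * b) * r = of_int b * (of_int N * r)" "of_int N * r \<in> \<int>"
        using N that by auto
      then show ?thesis
        by (metis Ints_mult Ints_of_int)
    qed
    then show ?case
      using N ab by (metis mult_pos_pos)
  qed
  then show thesis
    using that by blast
qed

text \<open>A maximal rationally independent \<open>B\<close> in \<open>F\<close> expresses each
  vector of \<open>F\<close> with rational coefficients. Dividing \<open>B\<close> by a common
  denominator turns these into integers, and \<open>l\<close> consists of the accordingly rescaled
  coordinate functionals.\<close>

lemma integral_dual_basis:
  fixes F :: "'a::real_vector set"
  assumes "finite F"
  obtains U and l :: "'a \<Rightarrow> 'a \<Rightarrow> real" where
    "finite U" "\<And>u v w. l u (v + w) = l u v + l u w"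
    "\<And>u u'. u \<in> U \<Longrightarrow> u' \<in> U \<Longrightarrow> l u u' = (if u' = u then 1 else 0)"
    "\<And>v. v \<in> F \<Longrightarrow> \<exists>c. v = (\<Sum>u\<in>U. of_int (c u) *\<^sub>R u)"
proof -
  \<comment> \<open>Scalars are restricted to the rationals because only rational linear relations
    between vectors constrain additive maps.\<close>
  interpret Q: vector_space_pair "\<lambda>(q::rat) (v::'a). of_rat q *\<^sub>R v" "\<lambda>(q::rat) (x::real). of_rat q * x"
    by unfold_locales (simp_all add: of_rat_add of_rat_mult algebra_simps)
  obtain B where B: "B \<subseteq> F" "Q.vs1.independent B" "F \<subseteq> Q.vs1.span B"
    using Q.vs1.maximal_independent_subset by blast
  have fin: "finite B"
    using B(1) assms by (rule finite_subset)
  have "\<forall>v\<in>F. \<exists>q. v = (\<Sum>b\<in>B. of_rat (q b) *\<^sub>R b)"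
    using B(3) by (auto simp: Q.vs1.span_finite[OF fin])
  then obtain q where q: "\<And>v. v \<in> F \<Longrightarrow> v = (\<Sum>b\<in>B. of_rat (q v b) *\<^sub>R b)"
    by metis
  obtain N :: int where N: "N > 0" "\<And>v b. v \<in> F \<Longrightarrow> b \<in> B \<Longrightarrow> of_int N * q v b \<in> \<int>"
    using common_denominator[of "\<Union>v\<in>F. q v ` B"] assms fin by (metis UN_I finite_UN_I finite_imageI imageI)
  define r where "r = (of_int N :: real)"
  have r: "r > 0"
    using N by (simp add: r_def)
  \<comment> \<open>The construction extends the prescribed values linearly to the whole space, not
    just to the span of \<open>B\<close>.\<close>
  define L where "L b = Q.construct B (\<lambda>b'. if b' = b then 1 else 0)" for b
  have add: "L b (v + w) = L b v + L b w" for b v w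
    unfolding L_def by (rule Q.linear_add[OF Q.linear_construct[OF B(2)]])
  have basis: "L b b' = (if b' = b then 1 else 0)" if "b' \<in> B" for b b'
    using Q.construct_basis[OF B(2) that] by (simp add: L_def)
  have inj: "inj_on (\<lambda>b. (1 / r) *\<^sub>R b) B"
    using r by (auto intro: inj_onI)
  show thesis
  proof
    show "finite ((\<lambda>b. (1 / r) *\<^sub>R b) ` B)"
      using fin by simp
    \<comment> \<open>Passing from \<open>b\<close> to \<open>b\<close> divided by \<open>r\<close>
      is undone in both arguments: the index recovers the original basis vector, and the scaled
      argument restores the value \<open>1\<close> on the diagonal.\<close>
    show "L (r *\<^sub>R u) (r *\<^sub>R (v + w)) = L (r *\<^sub>R u) (r *\<^sub>R v) + L (r *\<^sub>R u) (r *\<^sub>R w)" for u v w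
      by (simp add: scaleR_right_distrib add)
    show "L (r *\<^sub>R u) (r *\<^sub>R u') = (if u' = u then 1 else 0)"
      if "u \<in> (\<lambda>b. (1 / r) *\<^sub>R b) ` B" "u' \<in> (\<lambda>b. (1 / r) *\<^sub>R b) ` B" for u u'
      using that r by (auto simp: basis)
    fix v assume v: "v \<in> F"
    have "(of_rat (q v b) :: real) = of_int \<lfloor>of_int N * q v b\<rfloor> * (1 / r)" if "b \<in> B" for b
    proof -
      have "of_int \<lfloor>of_int N * q v b\<rfloor> = of_int N * q v b"
        using N(2)[OF v that] by (metis Ints_cases floor_of_int)
      then have "of_rat (of_int \<lfloor>of_int N * q v b\<rfloor>) = (of_rat (of_int N * q v b) :: real)"
        by (rule arg_cong)
      then show ?thesis
        using r by (simp add: r_def of_rat_mult)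
    qed
    then have "v = (\<Sum>b\<in>B. of_int \<lfloor>of_int N * q v b\<rfloor> *\<^sub>R (1 / r) *\<^sub>R b)"
      by (subst q[OF v]) (simp del: of_int_mult)
    also have "\<dots> = (\<Sum>u\<in>(\<lambda>b. (1 / r) *\<^sub>R b) ` B. of_int \<lfloor>of_int N * q v (r *\<^sub>R u)\<rfloor> *\<^sub>R u)"
      using r by (subst sum.reindex[OF inj]) simp
    finally show "\<exists>c. v = (\<Sum>u\<in>(\<lambda>b. (1 / r) *\<^sub>R b) ` B. of_int (c u) *\<^sub>R u)"
      by (rule exI[of _ "\<lambda>u. \<lfloor>of_int N * q v (r *\<^sub>R u)\<rfloor>"])
  qed
qed

section \<open>Continuous characters of the group of additive maps\<close>

text \<open>A neighbourhood of zero in the product topology restricts only finitely many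
  coordinates; these form \<open>F\<close>. The annihilator of \<open>F\<close> is closed under
  doubling, so its image under \<open>kappa\<close> has all iterated doubles near \<open>0\<close>
  and must be trivial.\<close>

lemma b_group_character_annihilator:
  fixes \<kappa> :: "('a::ab_group_add \<Rightarrow> circle) \<Rightarrow> circle"
  assumes cont: "continuous_map b_topology euclidean \<kappa>"
    and add: "\<And>\<phi> \<psi>. \<phi> \<in> carrier b_group \<Longrightarrow> \<psi> \<in> carrier b_group \<Longrightarrow>
      \<kappa> (\<lambda>v. \<phi> v + \<psi> v) = \<kappa> \<phi> + \<kappa> \<psi>"
  obtains F where "finite F" "\<And>\<phi>. \<phi> \<in> carrier b_group \<Longrightarrow> (\<And>v. v \<in> F \<Longrightarrow> \<phi> v = 0) \<Longrightarrow> \<kappa> \<phi> = 0"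
proof -
  \<comment> \<open>The radius \<open>1/2\<close> is the one for which repeated doubling leaves the
    disc.\<close>
  define V where "V = {c. norm (1 - circle_exp c) < 1/2}"
  have "open V"
    unfolding V_def by (intro open_Collect_less continuous_intros continuous_on_circle_exp)
  then have "openin b_topology {\<phi> \<in> carrier b_group. \<kappa> \<phi> \<in> V}"
    using openin_continuous_map_preimage[OF cont, of V] by (simp add: topspace_b_topology)
  then obtain U where U: "openin (product_topology (\<lambda>_. euclidean) UNIV) U"
    "{\<phi> \<in> carrier b_group. \<kappa> \<phi> \<in> V} = U \<inter> carrier b_group"
    unfolding b_topology_def openin_subtopology by blast
  have zero: "(\<lambda>_. 0) \<in> carrier (b_group :: ('a \<Rightarrow> circle) monoid)"
    by (simp add: b_group_def)
  have "\<kappa> (\<lambda>_. 0) = 0"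
    using add[OF zero zero] by (simp only: add_0_left add_cancel_right_right)
  then have "(\<lambda>_. 0) \<in> {\<phi> \<in> carrier b_group. \<kappa> \<phi> \<in> V}"
    using zero by (simp add: V_def circle_exp_0)
  then have "(\<lambda>_. 0) \<in> U"
    unfolding U(2) by blast
  then obtain W where W: "finite {v. W v \<noteq> UNIV}" "(\<lambda>_. 0) \<in> Pi\<^sub>E UNIV W" "Pi\<^sub>E UNIV W \<subseteq> U"
    using U(1) unfolding openin_product_topology_alt topspace_euclidean by (auto dest!: bspec)
  show thesis
  proof
    fix \<phi> :: "'a \<Rightarrow> circle"
    assume \<phi>: "\<phi> \<in> carrier b_group" and null: "\<And>v. v \<in> {v. W v \<noteq> UNIV} \<Longrightarrow> \<phi> v = 0"
    define d where "d \<psi> = (\<lambda>v. \<psi> v + \<psi> v)" for \<psi> :: "'a \<Rightarrow> circle"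
    have d_carr: "d \<psi> \<in> carrier b_group" if "\<psi> \<in> carrier b_group" for \<psi>
      using that by (simp add: d_def b_group_def algebra_simps)
    have iter: "(d ^^ n) \<phi> \<in> carrier b_group \<and> (\<forall>v. W v \<noteq> UNIV \<longrightarrow> (d ^^ n) \<phi> v = 0) \<and>
        \<kappa> ((d ^^ n) \<phi>) = ((\<lambda>b. b + b) ^^ n) (\<kappa> \<phi>)" for n
    proof (induction n)
      case 0
      then show ?case
        using \<phi> null by simp
    next
      case (Suc n)
      moreover from Suc have "\<kappa> (d ((d ^^ n) \<phi>)) = \<kappa> ((d ^^ n) \<phi>) + \<kappa> ((d ^^ n) \<phi>)"
        unfolding d_def by (intro add) auto
      moreover from Suc have "d ((d ^^ n) \<phi>) \<in> carrier b_group"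
        by (intro d_carr) simp
      moreover have "\<forall>v. W v \<noteq> UNIV \<longrightarrow> d ((d ^^ n) \<phi>) v = 0"
        using Suc unfolding d_def by simp
      ultimately show ?case
        by simp
    qed
    show "\<kappa> \<phi> = 0"
    proof (rule no_small_circle_subgroups)
      fix n
      \<comment> \<open>Coordinates in the finite set are zero, which the box around zero allows;
        the others are unrestricted.\<close>
      have "(d ^^ n) \<phi> v \<in> W v" for v
        using iter[of n] W(2) by (cases "W v = UNIV") (auto simp: PiE_iff)
      then have "(d ^^ n) \<phi> \<in> U"
        using W(3) by (auto simp: PiE_iff)
      then have "\<kappa> ((d ^^ n) \<phi>) \<in> V"
        using U(2) iter[of n] by blast
      then show "norm (1 - circle_exp (((\<lambda>b. b + b) ^^ n) (\<kappa> \<phi>))) < 1/2"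
        using iter[of n] by (simp add: V_def)
    qed
  qed (rule W(1))
qed

text \<open>The surjectivity half of Pontryagin duality for the discrete additive group of the
  space. Modulo the annihilator of \<open>U\<close>, every additive map is a sum of members of the
  one-parameter subgroups \<open>p u\<close>, so the slopes of the character along these determine
  it.\<close>

lemma b_group_character_eval:
  fixes \<kappa> :: "('a::real_vector \<Rightarrow> circle) \<Rightarrow> circle"
  assumes cont: "continuous_map b_topology euclidean \<kappa>"
    and add: "\<And>\<phi> \<psi>. \<phi> \<in> carrier b_group \<Longrightarrow> \<psi> \<in> carrier b_group \<Longrightarrow>
      \<kappa> (\<lambda>v. \<phi> v + \<psi> v) = \<kappa> \<phi> + \<kappa> \<psi>"
  obtains v where "\<And>\<phi>. \<phi> \<in> carrier b_group \<Longrightarrow> \<kappa> \<phi> = \<phi> v"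
proof -
  let ?B = "carrier (b_group :: ('a \<Rightarrow> circle) monoid)"
  obtain F where F: "finite F"
    "\<And>\<phi>. \<phi> \<in> ?B \<Longrightarrow> (\<And>v. v \<in> F \<Longrightarrow> \<phi> v = 0) \<Longrightarrow> \<kappa> \<phi> = 0"
    using b_group_character_annihilator[OF cont add] by metis
  obtain U and l :: "'a \<Rightarrow> 'a \<Rightarrow> real" where U: "finite U"
    and l_add: "\<And>u v w. l u (v + w) = l u v + l u w"
    and l_dual: "\<And>u u'. u \<in> U \<Longrightarrow> u' \<in> U \<Longrightarrow> l u u' = (if u' = u then 1 else 0)"
    and U_gen: "\<And>v. v \<in> F \<Longrightarrow> \<exists>c. v = (\<Sum>u\<in>U. of_int (c u) *\<^sub>R u)"
    by (rule integral_dual_basis[OF F(1)]) (rule that; assumption | blast)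
  \<comment> \<open>Integral coefficients are essential: the lifts \<open>t u\<close> are determined
    only modulo integers.\<close>
  have combination: "\<phi> (\<Sum>u\<in>U. of_int (c u) *\<^sub>R u) = abs_circle (\<Sum>u\<in>U. of_int (c u) * t u)"
    if \<phi>: "\<phi> \<in> ?B" and t: "\<And>u. u \<in> U \<Longrightarrow> \<phi> u = abs_circle (t u)" for \<phi> c t
  proof -
    interpret \<phi>: additive \<phi>
      using \<phi> by unfold_locales (simp add: b_group_def)
    have nat: "\<phi> (of_nat n *\<^sub>R u) = abs_circle (of_nat n * t u)" if "u \<in> U" for n u
      by (induction n)
        (simp_all add: \<phi>.zero \<phi>.add scaleR_left_distrib distrib_right abs_circle_add t[OF that]
          zero_circle_def)
    have "\<phi> (of_int m *\<^sub>R u) = abs_circle (of_int m * t u)" if "u \<in> U" for m u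
      using nat[OF that] \<phi>.minus
      by (cases m rule: int_cases2) (simp_all flip: uminus_circle.abs_eq)
    then show ?thesis
      by (simp add: \<phi>.sum abs_circle_sum)
  qed
  have vanish: "\<kappa> \<phi> = 0" if \<phi>: "\<phi> \<in> ?B" and "\<And>u. u \<in> U \<Longrightarrow> \<phi> u = 0" for \<phi>
  proof (rule F(2)[OF \<phi>])
    fix v assume "v \<in> F"
    then obtain c where "v = (\<Sum>u\<in>U. of_int (c u) *\<^sub>R u)"
      using U_gen by blast
    then show "\<phi> v = 0"
      using combination[OF \<phi>, of "\<lambda>_. 0" c] that(2) by (simp add: zero_circle_def)
  qed
  define p where "p u t = (\<lambda>v. abs_circle (t * l u v))" for u t
  have p: "p u t \<in> ?B" for u t
    by (simp add: p_def b_group_def l_add distrib_left abs_circle_add)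
  have p_add: "p u (s + t) = (\<lambda>v. p u s v + p u t v)" for u s t
    by (simp add: p_def distrib_right abs_circle_add)
  have "\<exists>c. \<forall>t. \<kappa> (p u t) = abs_circle (t * c)" for u
  proof -
    have "continuous_map euclidean b_topology (p u)"
    proof (rule continuous_map_into_b)
      show "continuous_map euclidean euclidean (\<lambda>t. p u t v)" for v
        unfolding p_def continuous_map_iff_continuous2
        by (intro continuous_on_compose2[OF continuous_on_abs_circle] continuous_intros) auto
    qed (use p in auto)
    then have "continuous_on UNIV (\<lambda>t. \<kappa> (p u t))"
      using continuous_map_compose[OF _ cont] by (fastforce simp: o_def)
    then show ?thesis
      by (rule continuous_additive_circle) (auto simp: p_add add[OF p p])
  qed
  then obtain c where c: "\<And>u t. \<kappa> (p u t) = abs_circle (t * c u)"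
    by metis
  \<comment> \<open>At time \<open>1\<close> the one-parameter subgroup takes integer values on
    \<open>U\<close> before projection, so it lies in the annihilator of \<open>U\<close> and the
    slope must be an integer.\<close>
  have "c u \<in> \<int>" if "u \<in> U" for u
  proof -
    have "\<kappa> (p u 1) = 0"
      by (rule vanish[OF p]) (simp add: p_def l_dual[OF that] abs_circle_eq_0_iff)
    then show ?thesis
      by (simp add: c abs_circle_eq_0_iff)
  qed
  then have c_int: "of_int \<lfloor>c u\<rfloor> = c u" if "u \<in> U" for u
    using that by (metis Ints_cases floor_of_int)
  show thesis
  proof
    fix \<phi> assume \<phi>: "\<phi> \<in> ?B"
    have "\<forall>u. \<exists>t. \<phi> u = abs_circle t"
      using surj_abs_circle by (metis surjD)
    then obtain t where t: "\<And>u. \<phi> u = abs_circle (t u)"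
      by metis
    have part: "(\<lambda>v. \<Sum>u\<in>A. p u (t u) v) \<in> ?B \<and>
        \<kappa> (\<lambda>v. \<Sum>u\<in>A. p u (t u) v) = (\<Sum>u\<in>A. \<kappa> (p u (t u)))" if "finite A" for A
      using that
    proof (induction A)
      case empty
      have "(\<lambda>_. 0) \<in> ?B"
        by (simp add: b_group_def)
      then show ?case
        using vanish[of "\<lambda>_. 0"] by simp
    next
      case (insert u A)
      then have "\<kappa> (\<lambda>v. p u (t u) v + (\<Sum>u\<in>A. p u (t u) v)) = \<kappa> (p u (t u)) + \<kappa> (\<lambda>v. \<Sum>u\<in>A. p u (t u) v)"
        by (intro add p) auto
      moreover have "(\<lambda>v. p u (t u) v + (\<Sum>u\<in>A. p u (t u) v)) \<in> ?B"
        using insert p[of u "t u"] by (auto simp: b_group_def algebra_simps)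
      ultimately show ?case
        using insert by simp
    qed
    \<comment> \<open>This combination agrees with the given additive map on \<open>U\<close>, so
      the character cannot tell the two apart.\<close>
    define \<psi> where "\<psi> = (\<lambda>v. \<Sum>u\<in>U. p u (t u) v)"
    have \<psi>: "\<psi> \<in> ?B" "\<kappa> \<psi> = (\<Sum>u\<in>U. \<kappa> (p u (t u)))"
      using part[OF U] by (auto simp: \<psi>_def)
    have diff: "(\<lambda>v. \<phi> v - \<psi> v) \<in> ?B"
      using \<phi> \<psi> by (simp add: b_group_def algebra_simps)
    have "\<psi> u = \<phi> u" if "u \<in> U" for u
    proof -
      have "p u' (t u') u = (if u' = u then \<phi> u else 0)" if "u' \<in> U" for u'
        using l_dual[OF that \<open>u \<in> U\<close>] by (simp add: p_def t zero_circle_def)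
      then show ?thesis
        using U that by (simp add: \<psi>_def)
    qed
    then have "\<kappa> (\<lambda>v. \<phi> v - \<psi> v) = 0"
      by (intro vanish diff) simp
    then have "\<kappa> \<phi> = \<kappa> \<psi>"
      using add[OF diff \<psi>(1)] by simp
    also have "\<dots> = abs_circle (\<Sum>u\<in>U. t u * c u)"
      by (simp add: \<psi>(2) c abs_circle_sum)
    \<comment> \<open>Integrality of the slopes lets them change roles: they become the coefficients
      of a vector at which the given map is evaluated.\<close>
    also have "\<dots> = abs_circle (\<Sum>u\<in>U. of_int \<lfloor>c u\<rfloor> * t u)"
      by (intro arg_cong[where f = abs_circle] sum.cong) (simp_all add: c_int)
    also have "\<dots> = \<phi> (\<Sum>u\<in>U. of_int \<lfloor>c u\<rfloor> *\<^sub>R u)"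
      by (rule combination[OF \<phi> t, symmetric])
    finally show "\<kappa> \<phi> = \<phi> (\<Sum>u\<in>U. of_int \<lfloor>c u\<rfloor> *\<^sub>R u)" .
  qed
qed

text \<open>The inner product with \<open>d = v - w\<close>, scaled to take the value
  \<open>1/2\<close> at \<open>d\<close>, projects to an additive map under which \<open>v\<close>
  and \<open>w\<close> differ by the class of \<open>1/2\<close>.\<close>

lemma b_group_separates_points:
  fixes v w :: "'a::real_inner"
  assumes "\<And>\<phi>. \<phi> \<in> carrier b_group \<Longrightarrow> \<phi> v = \<phi> w"
  shows "v = w"
proof (rule ccontr)
  assume "v \<noteq> w"
  define d where "d = v - w"
  have d: "inner d d \<noteq> 0"
    using \<open>v \<noteq> w\<close> by (simp add: d_def)
  define \<phi> where "\<phi> x = abs_circle (inner x d / (2 * inner d d))" for x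
  have "\<phi> \<in> carrier b_group"
    by (simp add: b_group_def \<phi>_def inner_add_left add_divide_distrib abs_circle_add)
  then have "inner v d / (2 * inner d d) - inner w d / (2 * inner d d) \<in> \<int>"
    using assms[of \<phi>] by (simp add: \<phi>_def abs_circle_eq_iff)
  also have "inner v d / (2 * inner d d) - inner w d / (2 * inner d d) = inner d d / (2 * inner d d)"
    by (simp add: d_def inner_diff_left diff_divide_distrib)
  also have "\<dots> = 1/2"
    using d by simp
  finally have "(1/2 :: real) \<in> \<int>" .
  then show False
    using Ints_nonzero_abs_ge1[of "1/2 :: real"] by simp
qed

text \<open>For fixed \<open>w\<close>, evaluating the image at \<open>w\<close> is a continuous
  character of the source, hence evaluation at some vector, which is chosen as the value of the dual
  map at \<open>w\<close>.\<close>

lemma b_group_hom_dual: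
  fixes \<theta> :: "('a::real_vector \<Rightarrow> circle) \<Rightarrow> ('b::ab_group_add \<Rightarrow> circle)"
  assumes "\<theta> \<in> hom b_group b_group" and "continuous_map b_topology b_topology \<theta>"
  obtains \<eta> where "\<And>\<phi> w. \<phi> \<in> carrier b_group \<Longrightarrow> \<theta> \<phi> w = \<phi> (\<eta> w)"
proof -
  have "\<exists>v. \<forall>\<phi>\<in>carrier b_group. \<theta> \<phi> w = \<phi> v" for w
  proof -
    have "continuous_map b_topology euclidean (\<lambda>\<phi>. \<theta> \<phi> w)"
      using continuous_map_compose[OF assms(2) continuous_map_b_eval] by (simp add: o_def)
    moreover have "\<theta> (\<lambda>v. \<phi> v + \<psi> v) w = \<theta> \<phi> w + \<theta> \<psi> w"
      if "\<phi> \<in> carrier b_group" "\<psi> \<in> carrier b_group" for \<phi> \<psi>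
      using hom_mult[OF assms(1) that] by (simp add: b_group_def)
    ultimately show ?thesis
      by (rule b_group_character_eval) auto
  qed
  then show thesis
    using that by metis
qed

section \<open>Passing between additive conjugacies and conjugacies of the dual actions\<close>

theorem claim8:
  fixes G :: "('g, 'm) monoid_scheme"
    and \<pi> :: "'g \<Rightarrow> 'h \<Rightarrow> 'h::{real_inner, complete_space}"
    and \<pi>' :: "'g \<Rightarrow> 'k \<Rightarrow> 'k::{real_inner, complete_space}"
  assumes "group G" and "finitely_generated G"
    and "separable_space (euclidean :: 'h topology)"
    and "separable_space (euclidean :: 'k topology)"
    and "orthogonal_representation G \<pi>" and "orthogonal_representation G \<pi>'"
  shows "additive_conjugates G \<pi> \<pi>' \<longleftrightarrow>
    conjugate_algebraic_actions G b_group b_topology (b_action \<pi>)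
      b_group b_topology (b_action \<pi>')"
proof
  let ?B = "b_group :: ('h \<Rightarrow> circle) monoid" and ?B' = "b_group :: ('k \<Rightarrow> circle) monoid"
  have bij: "bij (\<pi> g)" and bij': "bij (\<pi>' g)" if "g \<in> carrier G" for g
    using assms(5,6) that
    by (auto simp: orthogonal_representation_def orthogonal_group_def hom_def Bij_def)
  show "conjugate_algebraic_actions G ?B b_topology (b_action \<pi>) ?B' b_topology (b_action \<pi>')"
    if conj: "additive_conjugates G \<pi> \<pi>'"
  proof -
    obtain \<xi> where \<xi>: "bij \<xi>" and \<xi>_add: "\<And>v w. \<xi> (v + w) = \<xi> v + \<xi> w"
      and \<xi>_equiv: "\<And>g v. g \<in> carrier G \<Longrightarrow> \<xi> (\<pi> g v) = \<pi>' g (\<xi> v)"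
      using conj unfolding additive_conjugates_def by blast
    define \<zeta> where "\<zeta> = inv_into UNIV \<xi>"
    have inv: "\<xi> (\<zeta> w) = w" "\<zeta> (\<xi> v) = v" for v w
      using \<xi> by (simp_all add: \<zeta>_def bij_is_surj bij_is_inj surj_f_inv_f)
    have \<zeta>_add: "\<zeta> (v + w) = \<zeta> v + \<zeta> w" for v w
      by (metis inv \<xi>_add)
    \<comment> \<open>Equivariance is restated for the inverse operators, the form in which they
      enter \<open>b_action\<close>.\<close>
    have \<zeta>_equiv: "inv_into UNIV (\<pi> g) (\<zeta> w) = \<zeta> (inv_into UNIV (\<pi>' g) w)" if g: "g \<in> carrier G" for g w
    proof (rule inv_f_eq[OF bij_is_inj[OF bij[OF g]]])
      have "\<xi> (\<pi> g (\<zeta> (inv_into UNIV (\<pi>' g) w))) = w"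
        using bij'[OF g] by (simp add: \<xi>_equiv[OF g] inv bij_is_surj surj_f_inv_f)
      then show "\<pi> g (\<zeta> (inv_into UNIV (\<pi>' g) w)) = \<zeta> w"
        by (metis inv(2))
    qed
    define \<theta> :: "('h \<Rightarrow> circle) \<Rightarrow> 'k \<Rightarrow> circle" where "\<theta> \<phi> = (\<lambda>w. \<phi> (\<zeta> w))" for \<phi>
    define \<theta>' :: "('k \<Rightarrow> circle) \<Rightarrow> 'h \<Rightarrow> circle" where "\<theta>' \<psi> = (\<lambda>v. \<psi> (\<xi> v))" for \<psi>
    have carr: "\<theta> \<phi> \<in> carrier ?B'" if "\<phi> \<in> carrier ?B" for \<phi>
      using that by (simp add: b_group_def \<theta>_def \<zeta>_add)
    have carr': "\<theta>' \<psi> \<in> carrier ?B" if "\<psi> \<in> carrier ?B'" for \<psi>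
      using that by (simp add: b_group_def \<theta>'_def \<xi>_add)
    have inverse: "\<theta>' (\<theta> \<phi>) = \<phi>" "\<theta> (\<theta>' \<psi>) = \<psi>" for \<phi> \<psi>
      by (simp_all add: \<theta>_def \<theta>'_def inv)
    have "\<theta> \<in> hom ?B ?B'"
      by (rule homI) (simp_all add: carr, simp add: \<theta>_def b_group_def)
    moreover have "bij_betw \<theta> (carrier ?B) (carrier ?B')"
      by (rule bij_betw_byWitness[where f' = \<theta>']) (auto simp: inverse carr carr')
    ultimately have iso: "\<theta> \<in> iso ?B ?B'"
      by (simp add: iso_def)
    have "homeomorphic_maps b_topology b_topology \<theta> \<theta>'"
      unfolding homeomorphic_maps_def
    proof (intro conjI)
      show "continuous_map b_topology b_topology \<theta>"
      proof (rule continuous_map_into_b)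
        show "continuous_map b_topology euclidean (\<lambda>\<phi>. \<theta> \<phi> v)" for v
          unfolding \<theta>_def by (rule continuous_map_b_eval)
      qed (use carr in \<open>simp add: topspace_b_topology\<close>)
      show "continuous_map b_topology b_topology \<theta>'"
      proof (rule continuous_map_into_b)
        show "continuous_map b_topology euclidean (\<lambda>\<phi>. \<theta>' \<phi> v)" for v
          unfolding \<theta>'_def by (rule continuous_map_b_eval)
      qed (use carr' in \<open>simp add: topspace_b_topology\<close>)
    qed (simp_all add: inverse)
    then have homeo: "homeomorphic_map b_topology b_topology \<theta>"
      using homeomorphic_map_maps by blast
    have "\<theta> (b_action \<pi> g \<phi>) = b_action \<pi>' g (\<theta> \<phi>)"
      if "g \<in> carrier G" "\<phi> \<in> carrier ?B" for g \<phi>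
      using that carr by (simp add: b_action_def) (simp add: \<theta>_def \<zeta>_equiv)
    then show ?thesis
      using iso homeo algebraic_action_b[OF assms(1,5)] algebraic_action_b[OF assms(1,6)]
      unfolding conjugate_algebraic_actions_def by blast
  qed
  show "additive_conjugates G \<pi> \<pi>'"
    if conj: "conjugate_algebraic_actions G ?B b_topology (b_action \<pi>) ?B' b_topology (b_action \<pi>')"
  proof -
    obtain \<theta> where iso: "\<theta> \<in> iso ?B ?B'" and homeo: "homeomorphic_map b_topology b_topology \<theta>"
      and equiv: "\<And>g \<phi>. g \<in> carrier G \<Longrightarrow> \<phi> \<in> carrier ?B \<Longrightarrow>
        \<theta> (b_action \<pi> g \<phi>) = b_action \<pi>' g (\<theta> \<phi>)"
      using conj unfolding conjugate_algebraic_actions_def by blast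
    have hom: "\<theta> \<in> hom ?B ?B'"
      using iso by (simp add: iso_def)
    obtain \<theta>' where maps: "homeomorphic_maps b_topology b_topology \<theta> \<theta>'"
      using homeo homeomorphic_map_maps by blast
    then have inverse: "\<And>\<phi>. \<phi> \<in> carrier ?B \<Longrightarrow> \<theta>' (\<theta> \<phi>) = \<phi>"
      "\<And>\<psi>. \<psi> \<in> carrier ?B' \<Longrightarrow> \<theta> (\<theta>' \<psi>) = \<psi>"
      by (auto simp: homeomorphic_maps_def topspace_b_topology)
    have cont: "continuous_map b_topology b_topology \<theta>" "continuous_map b_topology b_topology \<theta>'"
      using maps by (auto simp: homeomorphic_maps_def)
    have carr: "\<And>\<phi>. \<phi> \<in> carrier ?B \<Longrightarrow> \<theta> \<phi> \<in> carrier ?B'"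
      and carr': "\<And>\<psi>. \<psi> \<in> carrier ?B' \<Longrightarrow> \<theta>' \<psi> \<in> carrier ?B"
      using cont[THEN continuous_map_funspace] by (auto simp: topspace_b_topology)
    have hom': "\<theta>' \<in> hom ?B' ?B"
    proof (rule homI)
      fix \<phi> \<psi> assume "\<phi> \<in> carrier ?B'" "\<psi> \<in> carrier ?B'"
      then show "\<theta>' (\<phi> \<otimes>\<^bsub>?B'\<^esub> \<psi>) = \<theta>' \<phi> \<otimes>\<^bsub>?B\<^esub> \<theta>' \<psi>"
        by (metis hom_mult[OF hom] inverse carr' group.is_monoid group_b_group monoid.m_closed)
    qed (rule carr')
    obtain \<eta> where \<eta>: "\<And>\<phi> w. \<phi> \<in> carrier ?B \<Longrightarrow> \<theta> \<phi> w = \<phi> (\<eta> w)"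
      using b_group_hom_dual[OF hom cont(1)] by blast
    obtain \<xi> where "\<And>\<psi> v. \<psi> \<in> carrier ?B' \<Longrightarrow> \<theta>' \<psi> v = \<psi> (\<xi> v)"
      using b_group_hom_dual[OF hom' cont(2)] by blast
    \<comment> \<open>Substituting the image of an additive map under the isomorphism for
      \<open>\<psi>\<close> expresses the dual of the inverse through the isomorphism
      itself.\<close>
    then have \<xi>: "\<theta> \<phi> (\<xi> v) = \<phi> v" if "\<phi> \<in> carrier ?B" for \<phi> v
      using that carr inverse(1) by metis
    \<comment> \<open>The isomorphism is onto, so its images already separate points of the second
      space.\<close>
    have sep: "v = w" if "\<And>\<phi>. \<phi> \<in> carrier ?B \<Longrightarrow> \<theta> \<phi> v = \<theta> \<phi> w" for v w
    proof (rule b_group_separates_points)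
      show "\<psi> v = \<psi> w" if "\<psi> \<in> carrier ?B'" for \<psi>
        using \<open>\<And>\<phi>. \<phi> \<in> carrier ?B \<Longrightarrow> \<theta> \<phi> v = \<theta> \<phi> w\<close>[OF carr'[OF that]] inverse(2)[OF that] by simp
    qed
    have "bij \<xi>"
    proof (rule o_bij)
      have "\<eta> (\<xi> v) = v" for v
        by (rule b_group_separates_points) (simp add: \<xi> flip: \<eta>)
      then show "\<eta> \<circ> \<xi> = id"
        by (simp add: fun_eq_iff)
      \<comment> \<open>Testing against an image, the defining identities of \<open>\<xi>\<close>
        and \<open>\<eta>\<close> cancel successively.\<close>
      have "\<xi> (\<eta> w) = w" for w
        by (rule sep) (metis \<xi> \<eta>)
      then show "\<xi> \<circ> \<eta> = id"
        by (simp add: fun_eq_iff)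
    qed
    moreover have "\<xi> (v + w) = \<xi> v + \<xi> w" for v w
    proof (rule sep)
      fix \<phi> assume \<phi>: "\<phi> \<in> carrier ?B"
      then have "\<theta> \<phi> (\<xi> v + \<xi> w) = \<theta> \<phi> (\<xi> v) + \<theta> \<phi> (\<xi> w)"
        using carr by (simp add: b_group_def)
      then show "\<theta> \<phi> (\<xi> (v + w)) = \<theta> \<phi> (\<xi> v + \<xi> w)"
        using \<phi> by (simp add: \<xi>) (simp add: b_group_def)
    qed
    moreover have "\<xi> (\<pi> g v) = \<pi>' g (\<xi> v)" if g: "g \<in> carrier G" for g v
    proof -
      \<comment> \<open>Moving the second operator to the left as an inverse produces exactly the
        expression that \<open>b_action\<close> evaluates, so equivariance of the isomorphism
        applies.\<close>
      have "inv_into UNIV (\<pi>' g) (\<xi> (\<pi> g v)) = \<xi> v"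
      proof (rule sep)
        fix \<phi> assume \<phi>: "\<phi> \<in> carrier ?B"
        have act: "b_action \<pi> g \<phi> \<in> carrier ?B"
          using algebraic_action_b[OF assms(1,5)] g \<phi>
          by (auto simp: algebraic_action_def hom_def continuous_automorphisms_def auto_def Pi_iff)
        have "\<theta> \<phi> (inv_into UNIV (\<pi>' g) (\<xi> (\<pi> g v))) = \<theta> (b_action \<pi> g \<phi>) (\<xi> (\<pi> g v))"
          using carr[OF \<phi>] by (simp add: equiv[OF g \<phi>]) (simp add: b_action_def)
        also have "\<dots> = b_action \<pi> g \<phi> (\<pi> g v)"
          by (rule \<xi>[OF act])
        also have "\<dots> = \<theta> \<phi> (\<xi> v)"
          using \<phi> bij[OF g] by (simp add: \<xi> b_action_def bij_is_inj)
        finally show "\<theta> \<phi> (inv_into UNIV (\<pi>' g) (\<xi> (\<pi> g v))) = \<theta> \<phi> (\<xi> v)" .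
      qed
      then show ?thesis
        using bij'[OF g] by (metis bij_is_surj surj_f_inv_f)
    qed
    ultimately show ?thesis
      unfolding additive_conjugates_def by blast
  qed
qed

end
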